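(* Let $(m,n,r)$ be a triple of natural numbers with $m,n\ge 1$, $\gcd(m,n)=\gcd(m,r-1)=1$ and $r^n\equiv 1 \pmod m$, and let $ZM(m,n,r)=\langle a,b \mid a^m=b^n=1,\ b^{-1}ab=a^r\rangle$. Then the cyclic factorization number of $ZM(m,n,r)$ is $$CF_2(ZM(m,n,r))=\sum_{\substack{m_2\mid m,\ m_3\mid m\\ n_2\mid n,\ n_3\mid n\\ \gcd(m_2,m_3)=1\\ \gcd(n_2,n_3)=1\\ \frac{m}{m_2}\mid r^{n_2}-1,\ \frac{m}{m_3}\mid r^{n_3}-1}}\gcd\left(m_2,\frac{r^n-1}{r^{n_2}-1}\right)\gcd\left(m_3,\frac{r^n-1}{r^{n_3}-1}\right),$$ where the sum runs over all quadruples $(m_2,m_3,n_2,n_3)$ of positive integers satisfying the listed conditions. In particular, $CF_2(ZM(9,4,8))=36$.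
   Context: For a finite group $G$, $L_1(G)$ denotes the set (poset) of all cyclic subgroups of $G$, and the cyclic factorization number of $G$ is $CF_2(G)=|\{(H,K)\in L_1(G)^2 \mid HK=G\}|$ (ordered pairs), where $HK=\{hk\mid h\in H,k\in K\}$. A ZM-group $ZM(m,n,r)$ is the finite group of order $mn$ given by the presentation in the claim under the stated conditions on $(m,n,r)$. When $r=1$ (which forces $m=1$), the quotient $\frac{r^n-1}{r^{k}-1}$, for $k\mid n$, is read as $\sum_{i=0}^{n/k-1} r^{ik}$. *)

theory Defs
  imports "HOL-Algebra.Algebra" "HOL-Number_Theory.Cong"
begin

section \<open>Cyclic factorization number\<close>

definition cyclic_subgroups :: "('a, 'b) monoid_scheme \<Rightarrow> 'a set set" where
  "cyclic_subgroups G = {H. subgroup H G \<and> cyclic_group (G\<lparr>carrier := H\<rparr>)}"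

definition CF2 :: "('a, 'b) monoid_scheme \<Rightarrow> nat" where
  "CF2 G = card {(H, K). H \<in> cyclic_subgroups G \<and> K \<in> cyclic_subgroups G \<and>
                        H <#>\<^bsub>G\<^esub> K = carrier G}"

section \<open>Groups given by generators and relations\<close>

text \<open>A letter \<open>(x, False)\<close> stands for the generator \<open>x\<close>, and \<open>(x, True)\<close> for its formal inverse.
  Every element of the type \<open>'g\<close> is a generator. A relation \<open>u = v\<close> is the pair \<open>(u, v)\<close>.\<close>

type_synonym 'g word = "('g \<times> bool) list"

inductive pres_eq :: "('g word \<times> 'g word) set \<Rightarrow> 'g word \<Rightarrow> 'g word \<Rightarrow> bool"
  for R :: "('g word \<times> 'g word) set" where
  pres_refl: "pres_eq R u u"
| pres_sym: "pres_eq R u v \<Longrightarrow> pres_eq R v u"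
| pres_trans: "pres_eq R u v \<Longrightarrow> pres_eq R v w \<Longrightarrow> pres_eq R u w"
| pres_append: "pres_eq R u u' \<Longrightarrow> pres_eq R v v' \<Longrightarrow> pres_eq R (u @ v) (u' @ v')"
| pres_cancel: "pres_eq R [(x, s), (x, \<not> s)] []"
| pres_rel: "(u, v) \<in> R \<Longrightarrow> pres_eq R u v"

definition pres_class :: "('g word \<times> 'g word) set \<Rightarrow> 'g word \<Rightarrow> 'g word set" where
  "pres_class R u = {w. pres_eq R u w}"

definition presented_group :: "('g word \<times> 'g word) set \<Rightarrow> 'g word set monoid" where
  "presented_group R =
     \<lparr>carrier = range (pres_class R),
      monoid.mult = (\<lambda>A B. \<Union>u\<in>A. \<Union>v\<in>B. pres_class R (u @ v)),
      monoid.one = pres_class R []\<rparr>"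

lemma pres_class_eq_iff: "pres_class R u = pres_class R v \<longleftrightarrow> pres_eq R u v"
proof
  assume "pres_class R u = pres_class R v"
  then have "v \<in> pres_class R u" by (simp add: pres_class_def pres_refl)
  then show "pres_eq R u v" by (simp add: pres_class_def)
next
  assume uv: "pres_eq R u v"
  have "pres_eq R u w \<longleftrightarrow> pres_eq R v w" for w
    using pres_trans[OF uv] pres_trans[OF pres_sym[OF uv]] by blast
  then show "pres_class R u = pres_class R v" by (simp add: pres_class_def)
qed

lemma pres_class_mult:
  "pres_class R u \<otimes>\<^bsub>presented_group R\<^esub> pres_class R v = pres_class R (u @ v)"
proof -
  have eq: "pres_class R (u' @ v') = pres_class R (u @ v)"
    if "u' \<in> pres_class R u" "v' \<in> pres_class R v" for u' v'
  proof -
    have "pres_eq R u u'" "pres_eq R v v'"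
      using that by (simp_all add: pres_class_def)
    then have "pres_eq R (u' @ v') (u @ v)"
      by (rule pres_sym[OF pres_append])
    then show ?thesis by (simp add: pres_class_eq_iff)
  qed
  have "u \<in> pres_class R u" "v \<in> pres_class R v"
    by (simp_all add: pres_class_def pres_refl)
  then have ne: "pres_class R u \<noteq> {}" "pres_class R v \<noteq> {}"
    by blast+
  have "pres_class R u \<otimes>\<^bsub>presented_group R\<^esub> pres_class R v =
      (\<Union>u'\<in>pres_class R u. \<Union>v'\<in>pres_class R v. pres_class R (u' @ v'))"
    by (simp add: presented_group_def)
  also have "\<dots> = (\<Union>u'\<in>pres_class R u. \<Union>v'\<in>pres_class R v. pres_class R (u @ v))"
    by (intro SUP_cong refl eq)
  also have "\<dots> = pres_class R (u @ v)"
    by (simp only: UN_constant ne if_False)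
  finally show ?thesis .
qed

definition inv_word :: "'g word \<Rightarrow> 'g word" where
  "inv_word u = rev (map (\<lambda>(x, s). (x, \<not> s)) u)"

lemma pres_eq_inv_word: "pres_eq R (inv_word u @ u) []"
proof (induction u)
  case Nil
  show ?case by (simp add: inv_word_def pres_refl)
next
  case (Cons p u)
  obtain x s where p: "p = (x, s)" by (cases p)
  have "pres_eq R [(x, \<not> s), (x, s)] []"
    using pres_cancel[of R x "\<not> s"] by simp
  then have "pres_eq R (inv_word u @ [(x, \<not> s), (x, s)] @ u) (inv_word u @ [] @ u)"
    by (rule pres_append[OF pres_refl pres_append[OF _ pres_refl]])
  then have "pres_eq R (inv_word u @ [(x, \<not> s), (x, s)] @ u) []"
    by (rule pres_trans) (simp add: Cons.IH)
  then show ?case by (simp add: inv_word_def p)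
qed

lemma group_presented_group: "group (presented_group R)"
proof -
  have one: "\<one>\<^bsub>presented_group R\<^esub> = pres_class R []"
    and car: "carrier (presented_group R) = range (pres_class R)"
    by (simp_all add: presented_group_def)
  have "\<exists>v. pres_class R v \<otimes>\<^bsub>presented_group R\<^esub> pres_class R u = \<one>\<^bsub>presented_group R\<^esub>" for u
    by (rule exI[of _ "inv_word u"])
       (simp add: one pres_class_mult pres_class_eq_iff pres_eq_inv_word)
  then show ?thesis
    by (intro groupI) (auto simp: one car pres_class_mult)
qed

section \<open>ZM-groups\<close>

datatype zm_gen = Gen_a | Gen_b

definition zm_relations :: "nat \<Rightarrow> nat \<Rightarrow> nat \<Rightarrow> (zm_gen word \<times> zm_gen word) set" where
  "zm_relations m n r =
     {(replicate m (Gen_a, False), []),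
      (replicate n (Gen_b, False), []),
      ([(Gen_b, True), (Gen_a, False), (Gen_b, False)], replicate r (Gen_a, False))}"

definition ZM :: "nat \<Rightarrow> nat \<Rightarrow> nat \<Rightarrow> zm_gen word set monoid" where
  "ZM m n r = presented_group (zm_relations m n r)"

text \<open>The quotient $(r^n-1)/(r^k-1)$ for \<open>k dvd n\<close>. For \<open>r = 1\<close> it is $0/0$, and is read as
  the geometric sum; for \<open>r \<noteq> 1\<close> and \<open>n, k > 0\<close> the integer division is exact.\<close>

definition pow_quot :: "nat \<Rightarrow> nat \<Rightarrow> nat \<Rightarrow> int" where
  "pow_quot r n k =
     (if r = 1 then (\<Sum>i<n div k. int r ^ (i * k))
      else (int r ^ n - 1) div (int r ^ k - 1))"

end

theory Submission
  imports Defs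
begin

text \<open>
  Every element of the group is \<open>b\<^sup>i a\<^sup>j\<close> with \<open>i\<close> unique modulo \<open>n\<close> and \<open>j\<close> unique modulo \<open>m\<close>. Since
  \<open>m\<close> and \<open>n\<close> are coprime, a cyclic subgroup \<open>H\<close> has order \<open>(m/k)(n/l)\<close> for unique \<open>k | m\<close> and
  \<open>l | n\<close>. It is generated by commuting elements \<open>a\<^sup>k\<close> and \<open>b\<^sup>l a\<^sup>s\<close> of orders \<open>m/k\<close> and \<open>n/l\<close>.
  They commute iff \<open>m/k | r\<^sup>l - 1\<close>, the exponent \<open>s\<close> modulo \<open>m\<close> is determined by \<open>H\<close>, and
  \<open>s\<close> is admissible iff \<open>m | s q\<close> with \<open>q = (r\<^sup>n - 1)/(r\<^sup>l - 1)\<close>. There are \<open>gcd m q\<close> such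
  \<open>s\<close>, and this equals \<open>gcd k q\<close>, because \<open>q\<close> is congruent to the unit \<open>n/l\<close> modulo \<open>m/k\<close>.
  Two cyclic subgroups have product \<open>G\<close> iff their indices are coprime.
\<close>

section \<open>Cyclic subgroups and products of subgroups\<close>

context group
begin

text \<open>Integer powers in \<open>H\<close> agree with those in \<open>G\<close>, so cyclicity of
  \<open>H\<close> as a group of its own becomes the existence of a generator inside
  \<open>G\<close>.\<close>

lemma cyclic_subgroups_eq: "cyclic_subgroups G = {generate G {x} |x. x \<in> carrier G}"
proof (intro equalityI subsetI)
  fix H assume "H \<in> cyclic_subgroups G"
  then have H: "subgroup H G" and cyc: "cyclic_group (G\<lparr>carrier := H\<rparr>)"
    by (auto simp: cyclic_subgroups_def)
  interpret GH: group "G\<lparr>carrier := H\<rparr>" using H by (rule subgroup_imp_group)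
  obtain x where x: "x \<in> H" and eq: "H = range (\<lambda>n::int. x [^]\<^bsub>G\<lparr>carrier := H\<rparr>\<^esub> n)"
    using cyc unfolding GH.cyclic_group by auto
  have xG: "x \<in> carrier G" using x H subgroup.subset by blast
  have "H = range (\<lambda>n::int. x [^] n)"
    using eq int_pow_consistent[OF H x] by auto
  then have "H = generate G {x}" using generate_pow[OF xG] by auto
  then show "H \<in> {generate G {x} |x. x \<in> carrier G}" using xG by auto
next
  fix H assume "H \<in> {generate G {x} |x. x \<in> carrier G}"
  then obtain x where x: "x \<in> carrier G" and Hx: "H = generate G {x}" by auto
  have H: "subgroup H G" unfolding Hx using x by (intro generate_is_subgroup) auto
  interpret GH: group "G\<lparr>carrier := H\<rparr>" using H by (rule subgroup_imp_group)
  have xH: "x \<in> H" unfolding Hx by (simp add: generate.incl)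
  have "H = range (\<lambda>n::int. x [^] n)"
    using Hx generate_pow[OF x] by auto
  then have "H = range (\<lambda>n::int. x [^]\<^bsub>G\<lparr>carrier := H\<rparr>\<^esub> n)"
    using int_pow_consistent[OF H xH] by simp
  then have "cyclic_group (G\<lparr>carrier := H\<rparr>)"
    unfolding GH.cyclic_group using xH by auto
  then show "H \<in> cyclic_subgroups G" using H by (simp add: cyclic_subgroups_def)
qed

lemma card_dvd_card_of_subset:
  assumes K: "subgroup K G" and H: "subgroup H G" and "K \<subseteq> H"
  shows "card K dvd card H"
proof -
  have "card (rcosets\<^bsub>G\<lparr>carrier := H\<rparr>\<^esub> K) * card K = card H"
    using group.lagrange[OF subgroup_imp_group[OF H] subgroup_incl[OF assms]]
    by (simp add: order_def)
  then show ?thesis by (metis dvd_triv_right)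
qed

text \<open>Multiplication on \<open>H \<times> K\<close> has fibres of constant size: if
  \<open>y = h \<otimes> k\<close>, then
  \<open>t \<mapsto> (h \<otimes> t, inv t \<otimes> k)\<close> maps \<open>H \<inter> K\<close>
  bijectively onto the fibre over \<open>y\<close>.\<close>

lemma card_mult_card_inter:
  assumes fin: "finite (carrier G)" and H: "subgroup H G" and K: "subgroup K G"
  shows "card H * card K = card (H <#> K) * card (H \<inter> K)"
proof -
  interpret H: subgroup H G by fact
  interpret K: subgroup K G by fact
  have finHK: "finite (H \<times> K)"
    using fin H.subset K.subset finite_subset by blast
  define f where "f = (\<lambda>(h, k). h \<otimes> k)"
  have fibre: "card {p \<in> H \<times> K. f p = y} = card (H \<inter> K)" if y: "y \<in> f ` (H \<times> K)" for y
  proof -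
    obtain h k where hk: "h \<in> H" "k \<in> K" "y = h \<otimes> k" using y by (auto simp: f_def)
    have "bij_betw (\<lambda>t. (h \<otimes> t, inv t \<otimes> k)) (H \<inter> K) {p \<in> H \<times> K. f p = y}"
    proof (rule bij_betw_byWitness[where f' = "\<lambda>(h', k'). inv h \<otimes> h'"])
      show "\<forall>t\<in>H \<inter> K. (case (h \<otimes> t, inv t \<otimes> k) of (h', k') \<Rightarrow> inv h \<otimes> h') = t"
        using hk by (auto simp: m_assoc[symmetric])
      show "(\<lambda>t. (h \<otimes> t, inv t \<otimes> k)) ` (H \<inter> K) \<subseteq> {p \<in> H \<times> K. f p = y}"
        using hk by (auto simp: f_def m_assoc) (simp add: m_assoc[symmetric])
      have main: "inv h \<otimes> h' \<in> K \<and> inv (inv h \<otimes> h') \<otimes> k = k'"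
        if "h' \<in> H" "k' \<in> K" "h' \<otimes> k' = h \<otimes> k" for h' k'
      proof -
        have eq: "inv h \<otimes> h' = k \<otimes> inv k'"
          using that hk by (metis H.mem_carrier K.mem_carrier inv_closed inv_solve_left
              inv_solve_right m_assoc m_closed)
        show ?thesis unfolding eq using that hk
          by (simp add: inv_mult_group m_assoc)
      qed
      show "\<forall>p\<in>{p \<in> H \<times> K. f p = y}.
          (h \<otimes> (case p of (h', k') \<Rightarrow> inv h \<otimes> h'), inv (case p of (h', k') \<Rightarrow> inv h \<otimes> h') \<otimes> k) = p"
        using hk main by (auto simp: f_def m_assoc[symmetric])
      show "(\<lambda>(h', k'). inv h \<otimes> h') ` {p \<in> H \<times> K. f p = y} \<subseteq> H \<inter> K"
        using hk main by (auto simp: f_def)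
    qed
    then show ?thesis by (simp add: bij_betw_same_card)
  qed
  have "card H * card K = (\<Sum>p\<in>H \<times> K. 1)"
    by (simp add: card_cartesian_product)
  also have "\<dots> = (\<Sum>y\<in>f ` (H \<times> K). \<Sum>p\<in>{p \<in> H \<times> K. f p = y}. 1)"
    by (rule sum.image_gen[OF finHK])
  also have "\<dots> = card (f ` (H \<times> K)) * card (H \<inter> K)"
    using fibre by simp
  also have "f ` (H \<times> K) = H <#> K"
    by (auto simp: f_def set_mult_def)
  finally show ?thesis .
qed

text \<open>Cancelling \<open>?c\<close> from \<open>card H * d = card K * e\<close> leaves
  \<open>u * d = v * e\<close>, so coprimality yields \<open>e dvd u\<close>. The product formula
  then makes \<open>card (H <#> K) = u * card K\<close> a positive multiple of
  \<open>card K * e\<close>, the order of \<open>G\<close>.\<close>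

lemma set_mult_eq_carrier_of_coprime_index:
  assumes fin: "finite (carrier G)" and H: "subgroup H G" and K: "subgroup K G"
    and iH: "card H * d = card (carrier G)" and iK: "card K * e = card (carrier G)"
    and de: "coprime d e"
  shows "H <#> K = carrier G"
proof -
  let ?N = "card (carrier G)" and ?c = "card (H \<inter> K)"
  have N: "?N > 0" using fin by (auto simp: card_gt_0_iff)
  have c: "?c dvd card H" "?c dvd card K"
    using card_dvd_card_of_subset[OF subgroups_Inter_pair[OF H K]] H K by auto
  then obtain u v where u: "card H = ?c * u" and v: "card K = ?c * v" by (auto elim!: dvdE)
  have cpos: "?c > 0" using N iH u by (metis mult_is_0 not_gr_zero)
  have "?c * (u * d) = ?c * (v * e)"
    by (simp only: mult.assoc[symmetric] u[symmetric] v[symmetric] iH iK)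
  then have "u * d = v * e" using nat_mult_eq_cancel1[OF cpos] by blast
  then have "e dvd u * d" by simp
  then have "e dvd u" using de by (simp add: coprime_dvd_mult_left_iff coprime_commute)
  then obtain t where t: "u = e * t" by (auto elim!: dvdE)
  have "card (H <#> K) * ?c = ?c * u * card K"
    unfolding u[symmetric] using card_mult_card_inter[OF fin H K] by simp
  then have "?c * card (H <#> K) = ?c * (u * card K)" by (simp only: mult_ac)
  then have "card (H <#> K) = u * card K" using nat_mult_eq_cancel1[OF cpos] by blast
  also have "\<dots> = ?N * t" unfolding t iK[symmetric] by (simp only: mult_ac)
  finally have "card (H <#> K) = ?N * t" .
  moreover have "t > 0" using t u iH N by (metis mult_is_0 not_gr_zero)
  ultimately have "card (H <#> K) \<ge> ?N" by simp
  moreover have "H <#> K \<subseteq> carrier G"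
    using H K by (simp add: set_mult_closed subgroup.subset)
  ultimately show ?thesis using fin by (simp add: card_seteq)
qed

end

section \<open>Normal forms\<close>

text \<open>Only the relations are assumed here, so the rules for multiplying normal forms are
  available for the presented group before its normal forms are known to be distinct.\<close>

locale zm_relators = group G for G (structure) +
  fixes a b :: 'a and m n r :: nat
  assumes a_closed [simp]: "a \<in> carrier G" and b_closed [simp]: "b \<in> carrier G"
    and a_pow: "a [^] m = \<one>" and b_pow: "b [^] n = \<one>"
    and a_b: "a \<otimes> b = b \<otimes> a [^] r"
begin

definition w :: "nat \<Rightarrow> nat \<Rightarrow> 'a" where "w i j = b [^] i \<otimes> a [^] j"

lemma w_closed [simp]: "w i j \<in> carrier G"
  by (simp add: w_def)

lemma w_0_0: "w 0 0 = \<one>"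
  by (simp add: w_def)

lemma a_pow_b: "a [^] j \<otimes> b = b \<otimes> a [^] (j * r)" for j :: nat
proof (induction j)
  case (Suc j)
  have "a [^] Suc j \<otimes> b = a [^] j \<otimes> (a \<otimes> b)" by (simp add: m_assoc)
  also have "\<dots> = (a [^] j \<otimes> b) \<otimes> a [^] r" by (simp add: a_b m_assoc)
  also have "\<dots> = b \<otimes> a [^] (Suc j * r)"
    by (simp add: Suc m_assoc nat_pow_mult add.commute)
  finally show ?case .
qed simp

lemma a_pow_b_pow: "a [^] j \<otimes> b [^] k = b [^] k \<otimes> a [^] (j * r ^ k)" for j k :: nat
proof (induction k)
  case (Suc k)
  have "a [^] j \<otimes> b [^] Suc k = (a [^] j \<otimes> b [^] k) \<otimes> b" by (simp add: m_assoc)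
  also have "\<dots> = b [^] k \<otimes> (a [^] (j * r ^ k) \<otimes> b)" by (simp add: Suc m_assoc)
  also have "\<dots> = b [^] Suc k \<otimes> a [^] (j * r ^ Suc k)"
    by (simp add: a_pow_b m_assoc mult_ac)
  finally show ?case .
qed simp

lemma w_mult: "w i j \<otimes> w k l = w (i + k) (j * r ^ k + l)"
proof -
  have "w i j \<otimes> w k l = b [^] i \<otimes> (a [^] j \<otimes> b [^] k) \<otimes> a [^] l"
    by (simp add: w_def m_assoc)
  also have "\<dots> = (b [^] i \<otimes> b [^] k) \<otimes> (a [^] (j * r ^ k) \<otimes> a [^] l)"
    by (simp add: a_pow_b_pow m_assoc)
  finally show ?thesis by (simp add: w_def nat_pow_mult)
qed

lemma w_pow: "w k s [^] e = w (k * e) (s * (\<Sum>i<e. r ^ (i * k)))" for e :: nat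
proof (induction e)
  case 0
  then show ?case by (simp add: w_0_0)
next
  case (Suc e)
  \<comment> \<open>Splitting off the factor on the left makes the new term
    \<open>r ^ (k * e)\<close>, the last summand of the longer geometric sum.\<close>
  have "w k s [^] Suc e = w k s \<otimes> w k s [^] e"
    by (simp only: nat_pow_Suc2 w_closed)
  also have "\<dots> = w (k + k * e) (s * r ^ (k * e) + s * (\<Sum>i<e. r ^ (i * k)))"
    by (simp add: Suc w_mult)
  also have "\<dots> = w (k * Suc e) (s * (\<Sum>i<Suc e. r ^ (i * k)))"
    by (simp add: algebra_simps)
  finally show ?case .
qed

lemma pow_cong:
  fixes i k d :: nat
  assumes x: "x \<in> carrier G" "x [^] d = \<one>" and ik: "[i = k] (mod d)"
  shows "x [^] i = x [^] k"
proof -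
  have "[int i = int k] (mod int d)" using ik by (simp add: cong_int_iff)
  then have "int d dvd int i - int k" by (simp add: cong_iff_dvd_diff)
  moreover have "int (ord x) dvd int d" using x by (simp add: pow_eq_id)
  ultimately have "int (ord x) dvd int i - int k" by (rule dvd_trans[rotated])
  then show ?thesis using int_pow_eq[OF x(1), of "int i" "int k"]
    by (simp add: int_pow_int dvd_diff_commute)
qed

lemma w_cong: "[i = k] (mod n) \<Longrightarrow> [j = l] (mod m) \<Longrightarrow> w i j = w k l"
  unfolding w_def using pow_cong[OF b_closed b_pow] pow_cong[OF a_closed a_pow] by metis

end

section \<open>Counting cyclic subgroups\<close>

text \<open>For r^k different from 1 this is (r^(e k) - 1)/(r^k - 1), written without division so
  that r^k = 1 is covered. It is the factor by which \<open>w_pow\<close> multiplies the exponent of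
  \<open>a\<close>.\<close>

definition geo_sum :: "nat \<Rightarrow> nat \<Rightarrow> nat \<Rightarrow> nat" where
  "geo_sum r e k = (\<Sum>i<e. r ^ (i * k))"

section \<open>Divisibility and geometric sums\<close>

text \<open>The witness is \<open>d / gcd c d\<close>, which \<open>d\<close> divides only if the
  gcd is 1. It is the test exponent by which the order of an element shows that \<open>c\<close> is
  a unit modulo \<open>d\<close>.\<close>

lemma gcd_cofactorE:
  fixes c d :: nat
  assumes "d > 0"
  obtains u where "d dvd c * u" "d dvd u \<Longrightarrow> coprime c d"
proof -
  define g where "g = gcd c d"
  obtain u where u: "d = g * u" unfolding g_def by (metis dvdE gcd_dvd2)
  obtain v where v: "c = g * v" unfolding g_def by (metis dvdE gcd_dvd1)
  have "coprime c d" if "d dvd u"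
  proof -
    have "u > 0" "g > 0" using u assms by auto
    then have "g * u \<le> u" using that u by (simp add: dvd_imp_le)
    then have "g = 1" using \<open>u > 0\<close> \<open>g > 0\<close> by simp
    then show ?thesis by (simp add: g_def coprime_iff_gcd_eq_1)
  qed
  moreover have "c * u = d * v" by (simp add: u v)
  ultimately show ?thesis using that by (metis dvd_triv_left)
qed

text \<open>With \<open>m' = m / g\<close> coprime to \<open>q' = q / g\<close>, the condition says
  \<open>m' dvd s\<close>, and \<open>m = m' * g\<close> exceeds exactly \<open>g\<close> multiples
  of \<open>m'\<close>.\<close>

lemma card_dvd_mult:
  fixes m q :: nat
  assumes m: "m > 0"
  shows "card {s. s < m \<and> m dvd s * q} = gcd m q"
proof -
  define g m' q' where "g = gcd m q" and "m' = m div g" and "q' = q div g"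
  have g: "g > 0" "m = m' * g" "q = q' * g" using m by (simp_all add: g_def m'_def q'_def)
  have cop: "coprime m' q'" using m unfolding m'_def q'_def g_def
    by (intro div_gcd_coprime) auto
  have m': "m' > 0" using m g by simp
  have "m dvd s * q \<longleftrightarrow> m' dvd s" for s
    using g cop by (simp add: coprime_dvd_mult_left_iff mult.assoc[symmetric])
  then have "{s. s < m \<and> m dvd s * q} = (\<lambda>t. m' * t) ` {..<g}"
    using g m' by (auto elim!: dvdE)
  moreover have "inj_on (\<lambda>t. m' * t) {..<g}" using m' by (auto simp: inj_on_def)
  ultimately show ?thesis by (simp add: card_image g_def)
qed

text \<open>Every summand is 1 modulo \<open>c\<close>, so the sum is congruent to the unit
  \<open>e\<close>, and the factor \<open>c\<close> contributes nothing to the gcd.\<close>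

lemma gcd_mult_geo_sum:
  assumes r: "[r ^ k = 1] (mod c)" and cop: "coprime c e"
  shows "gcd (d * c) (geo_sum r e k) = gcd d (geo_sum r e k)"
proof -
  have "[r ^ (i * k) = 1] (mod c)" for i
    using cong_pow[OF r, of i] by (simp add: power_mult[symmetric] mult.commute)
  then have "[geo_sum r e k = (\<Sum>i<e. 1)] (mod c)"
    unfolding geo_sum_def by (intro cong_sum)
  then have "coprime c (geo_sum r e k)"
    using cop by (metis card_lessThan cong_imp_coprime cong_sym coprime_commute real_of_card sum_constant
      mult.right_neutral of_nat_id)
  then show ?thesis
    using gcd_mult_right_right_cancel[of "geo_sum r e k" c d] by (metis coprime_commute gcd.commute)
qed

locale zm_group = zm_relators +
  assumes m_pos: "m > 0" and n_pos: "n > 0" and coprime_m_n: "coprime m n"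
    and span: "x \<in> carrier G \<Longrightarrow> \<exists>i j. x = w i j"
    and w_eqD: "w i j = w k l \<Longrightarrow> [i = k] (mod n) \<and> [j = l] (mod m)"
begin

lemma w_eq_iff: "w i j = w k l \<longleftrightarrow> [i = k] (mod n) \<and> [j = l] (mod m)"
  using w_eqD w_cong by blast

lemma w_eq_one_iff: "w i j = \<one> \<longleftrightarrow> n dvd i \<and> m dvd j"
  using w_eq_iff[of i j 0 0] by (simp add: w_0_0 cong_0_iff)

lemma bij_w: "bij_betw (\<lambda>(i, j). w i j) ({..<n} \<times> {..<m}) (carrier G)"
proof -
  have "x \<in> (\<lambda>(i, j). w i j) ` ({..<n} \<times> {..<m})" if "x \<in> carrier G" for x
  proof -
    obtain i j where "x = w i j" using span \<open>x \<in> carrier G\<close> by blast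
    then have "x = w (i mod n) (j mod m)" by (simp add: w_eq_iff)
    then show ?thesis using m_pos n_pos by (intro image_eqI[of _ _ "(i mod n, j mod m)"]) auto
  qed
  then show ?thesis
    by (auto simp: bij_betw_def inj_on_def w_eq_iff cong_less_modulus_unique_nat)
qed

lemma finite_carrier: "finite (carrier G)"
  using bij_betw_finite[OF bij_w] by simp

lemma card_carrier: "card (carrier G) = m * n"
  using bij_betw_same_card[OF bij_w] by (simp add: card_cartesian_product mult.commute)

text \<open>Finiteness makes natural exponents sufficient, so that \<open>w_pow\<close> computes all
  elements of a cyclic subgroup.\<close>

lemma cyclic_subgroupE:
  assumes "H \<in> cyclic_subgroups G"
  obtains x where "x \<in> carrier G" "ord x = card H" "H = range (\<lambda>k::nat. x [^] k)"
  using assms generate_pow_on_finite_carrier[OF finite_carrier] generate_pow_card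
  unfolding cyclic_subgroups_eq by fastforce

lemma cyclic_subgroup_subgroup: "H \<in> cyclic_subgroups G \<Longrightarrow> subgroup H G"
  by (simp add: cyclic_subgroups_def)

section \<open>Cyclic subgroups of order \<open>\<alpha> * \<beta>\<close>\<close>

context
  fixes m1 n1 \<alpha> \<beta> :: nat
  assumes m_eq: "m = m1 * \<alpha>" and n_eq: "n = n1 * \<beta>"
begin

lemma pos: "m1 > 0" "\<alpha> > 0" "n1 > 0" "\<beta> > 0"
  using m_pos n_pos m_eq n_eq by auto

lemma coprimes: "coprime \<alpha> \<beta>" "coprime n1 \<alpha>" "coprime m \<beta>" "coprime n \<alpha>"
  using coprime_m_n unfolding m_eq n_eq by (auto simp: coprime_commute)

lemma w_pow_eq_one_iff: "w n1 s [^] \<beta> = \<one> \<longleftrightarrow> m dvd s * geo_sum r \<beta> n1"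
  by (simp add: w_pow w_eq_one_iff geo_sum_def n_eq)

text \<open>Exponents of \<open>b\<close> add up under multiplication, so \<open>n\<close> divides
  \<open>i * (\<alpha> * \<beta>)\<close>. Cancelling \<open>\<beta>\<close>, and then
  \<open>\<alpha>\<close>, which is coprime to \<open>n1\<close>, leaves the claim.\<close>

lemma dvd_exponent:
  assumes "w i j [^] (\<alpha> * \<beta>) = \<one>"
  shows "n1 dvd i"
proof -
  have "n1 * \<beta> dvd i * (\<alpha> * \<beta>)" using assms by (simp add: w_pow w_eq_one_iff n_eq)
  then have "n1 dvd i * \<alpha>" using pos by (simp add: mult.assoc[symmetric])
  then show ?thesis using coprimes by (simp add: coprime_dvd_mult_left_iff)
qed

text \<open>The products are \<open>w n1 (s + m1)\<close> and \<open>w n1 (s + m1 * r ^ n1)\<close>.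
  Comparing exponents of \<open>a\<close> modulo \<open>m1 * \<alpha>\<close> removes
  \<open>s\<close>, and then \<open>m1\<close> cancels.\<close>

lemma w_commute_iff:
  "w n1 s \<otimes> w 0 m1 = w 0 m1 \<otimes> w n1 s \<longleftrightarrow> [r ^ n1 = 1] (mod \<alpha>)"
proof -
  have "w n1 s \<otimes> w 0 m1 = w 0 m1 \<otimes> w n1 s \<longleftrightarrow> [m1 * r ^ n1 = m1 * 1] (mod (m1 * \<alpha>))"
  proof -
    have "w n1 s \<otimes> w 0 m1 = w n1 (s + m1)" "w 0 m1 \<otimes> w n1 s = w n1 (s + m1 * r ^ n1)"
      by (simp_all add: w_mult add.commute)
    then show ?thesis by (auto simp: w_eq_iff m_eq cong_add_lcancel_nat cong_sym_eq)
  qed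
  also have "\<dots> \<longleftrightarrow> [r ^ n1 = 1] (mod \<alpha>)"
    using pos by (simp only: cong_def mult_mod_right[symmetric] mult_cancel1) auto
  finally show ?thesis .
qed

text \<open>For a generator \<open>x\<close>, the power \<open>x [^] \<beta>\<close> is killed by
  \<open>\<alpha>\<close>, which is coprime to \<open>n\<close>, so it is a power
  \<open>w 0 l\<close> of \<open>a\<close> with \<open>l = m1 * c\<close>. As its order is exactly
  \<open>\<alpha>\<close>, the cofactor \<open>c\<close> is a unit modulo \<open>\<alpha>\<close>,
  and a further power gives \<open>w 0 m1\<close>.\<close>

lemma rotation_mem:
  assumes H: "H \<in> cyclic_subgroups G" and card: "card H = \<alpha> * \<beta>"
  shows "w 0 m1 \<in> H"
proof -
  obtain x where x: "x \<in> carrier G" "ord x = \<alpha> * \<beta>" "H = range (\<lambda>k::nat. x [^] k)"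
    using cyclic_subgroupE[OF H] card by metis
  obtain k l where kl: "x [^] \<beta> = w k l" using span x by blast
  have "w k l [^] \<alpha> = \<one>" using x by (simp add: kl[symmetric] nat_pow_pow pow_eq_id mult.commute)
  then have "n dvd k * \<alpha>" "m dvd l * (\<Sum>i<\<alpha>. r ^ (i * k))"
    by (auto simp: w_pow w_eq_one_iff)
  then have "n dvd k" using coprimes by (simp add: coprime_dvd_mult_left_iff)
  then have xl: "x [^] \<beta> = w 0 l" using kl by (simp add: w_eq_iff cong_0_iff)
  have "w 0 l [^] \<alpha> = \<one>" using x by (simp add: xl[symmetric] nat_pow_pow pow_eq_id mult.commute)
  then have "m1 * \<alpha> dvd l * \<alpha>" by (simp add: w_pow w_eq_one_iff m_eq)
  then obtain c where c: "l = m1 * c" using pos by (auto elim!: dvdE)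
  obtain u where u: "\<alpha> dvd c * u" "\<alpha> dvd u \<Longrightarrow> coprime c \<alpha>"
    using pos gcd_cofactorE by metis
  have "m1 * \<alpha> dvd l * u" using c u by (simp add: mult.assoc)
  then have "w 0 l [^] u = \<one>" by (simp add: w_pow w_eq_one_iff m_eq)
  then have "\<alpha> * \<beta> dvd \<beta> * u" using x by (simp add: xl[symmetric] nat_pow_pow pow_eq_id)
  then have "\<alpha> dvd u" using pos by (simp add: mult.commute)
  then have "coprime c \<alpha>" by (rule u)
  then obtain t where "[c * t = 1] (mod \<alpha>)" using cong_solve_coprime_nat by (metis One_nat_def)
  then have "[m1 * (c * t) = m1 * 1] (mod (m1 * \<alpha>))"
    by (simp add: cong_def mult_mod_right[symmetric])
  then have "w 0 l [^] t = w 0 m1" by (simp add: w_pow w_eq_iff m_eq c mult_ac)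
  then have "x [^] (\<beta> * t) = w 0 m1" using x by (simp add: xl[symmetric] nat_pow_pow)
  then show ?thesis using x by (metis rangeI)
qed

text \<open>The same argument for \<open>x [^] \<alpha>\<close>: its exponent of \<open>b\<close> is
  \<open>n1 * c\<close> with \<open>c\<close> a unit modulo \<open>\<beta>\<close>, so some power of
  it has the form \<open>w n1 s\<close>.\<close>

lemma complement_mem:
  assumes H: "H \<in> cyclic_subgroups G" and card: "card H = \<alpha> * \<beta>"
  obtains s where "s < m" "w n1 s \<in> H" "w n1 s [^] \<beta> = \<one>"
proof -
  obtain x where x: "x \<in> carrier G" "ord x = \<alpha> * \<beta>" "H = range (\<lambda>k::nat. x [^] k)"
    using cyclic_subgroupE[OF H] card by metis
  obtain i j where ij: "x [^] \<alpha> = w i j" using span x by blast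
  have "w i j [^] (\<alpha> * \<beta>) = \<one>"
    using x by (simp add: ij[symmetric] nat_pow_pow pow_eq_id)
  then obtain c where c: "i = n1 * c" using dvd_exponent by (auto elim!: dvdE)
  obtain u where u: "\<beta> dvd c * u" "\<beta> dvd u \<Longrightarrow> coprime c \<beta>"
    using pos gcd_cofactorE by metis
  have "n1 * \<beta> dvd i * u" using c u by (simp add: mult.assoc)
  moreover obtain y where "w i j [^] u = w (i * u) y" by (simp add: w_pow)
  ultimately have "w i j [^] u = w 0 y" by (simp add: w_eq_iff cong_0_iff n_eq)
  \<comment> \<open>A power of \<open>a\<close> is killed by \<open>m\<close>; since
    \<open>m\<close> is coprime to \<open>\<beta>\<close>, this extra factor drops out of
    \<open>\<beta> dvd u * m\<close>.\<close>
  then have "(w i j [^] u) [^] m = \<one>" by (simp add: w_pow w_eq_one_iff)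
  then have "w i j [^] (u * m) = \<one>" by (simp add: nat_pow_pow)
  then have "\<alpha> * \<beta> dvd \<alpha> * (u * m)" using x by (simp add: ij[symmetric] nat_pow_pow pow_eq_id)
  then have "\<beta> dvd u" using pos coprimes by (simp add: coprime_dvd_mult_left_iff coprime_commute)
  then have "coprime c \<beta>" by (rule u)
  then obtain t where "[c * t = 1] (mod \<beta>)" using cong_solve_coprime_nat by (metis One_nat_def)
  then have it: "[i * t = n1] (mod n)"
    by (simp add: c n_eq cong_def mult_mod_right[symmetric] mult.assoc)
  obtain l where "w i j [^] t = w (i * t) l" by (simp add: w_pow)
  then have "x [^] (\<alpha> * t) = w n1 (l mod m)"
    using x it by (simp add: ij[symmetric] nat_pow_pow w_eq_iff)
  moreover have "(x [^] (\<alpha> * t)) [^] \<beta> = \<one>"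
    using x by (simp add: nat_pow_pow pow_eq_id mult_ac)
  moreover have "x [^] (\<alpha> * t) \<in> H" using x by auto
  ultimately show ?thesis using m_pos by (intro that[of "l mod m"]) auto
qed

text \<open>Both \<open>w n1 s\<close> and \<open>w 0 m1\<close> lie in \<open>H\<close>, hence are
  powers of one generator and commute.\<close>

lemma cyclic_imp_cong:
  assumes H: "H \<in> cyclic_subgroups G" and card: "card H = \<alpha> * \<beta>"
  shows "[r ^ n1 = 1] (mod \<alpha>)"
proof -
  obtain x where x: "x \<in> carrier G" "H = range (\<lambda>k::nat. x [^] k)"
    using cyclic_subgroupE[OF H] by metis
  obtain s where s: "w n1 s \<in> H" using complement_mem[OF H card] .
  obtain i k :: nat where "w n1 s = x [^] i" "w 0 m1 = x [^] k"
    using s rotation_mem[OF H card] x by auto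
  then have "w n1 s \<otimes> w 0 m1 = w 0 m1 \<otimes> w n1 s"
    using x by (simp add: nat_pow_mult add.commute)
  then show ?thesis by (simp add: w_commute_iff)
qed

text \<open>The element is the product of the commuting elements \<open>w n1 s\<close> and
  \<open>w 0 m1\<close>. If its power by \<open>e\<close> is trivial, the exponent of
  \<open>b\<close> gives \<open>\<beta> dvd e\<close>; this kills the first factor, and the second
  has order \<open>\<alpha>\<close>.\<close>

lemma ord_w:
  assumes r: "[r ^ n1 = 1] (mod \<alpha>)" and s: "w n1 s [^] \<beta> = \<one>"
  shows "ord (w n1 (s + m1)) = \<alpha> * \<beta>"
proof -
  have split: "w n1 (s + m1) [^] e = w n1 s [^] e \<otimes> w 0 m1 [^] e" for e :: nat
    using pow_mult_distrib[of "w n1 s" "w 0 m1" e] w_commute_iff[of s] r by (simp add: w_mult)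
  have a: "w 0 m1 [^] e = \<one> \<longleftrightarrow> \<alpha> dvd e" for e :: nat
    using pos by (simp add: w_pow w_eq_one_iff m_eq)
  have "w n1 (s + m1) [^] e = \<one> \<longleftrightarrow> \<alpha> * \<beta> dvd e" for e :: nat
  proof
    assume e: "w n1 (s + m1) [^] e = \<one>"
    then have "n1 * \<beta> dvd n1 * e" by (simp add: w_pow w_eq_one_iff n_eq)
    then have \<beta>: "\<beta> dvd e" using pos by simp
    then have "w n1 s [^] e = \<one>" using s by (metis dvdE nat_pow_one nat_pow_pow w_closed)
    then have "\<alpha> dvd e" using e a by (simp add: split)
    then show "\<alpha> * \<beta> dvd e" using \<beta> coprimes by (simp add: divides_mult)
  next
    assume "\<alpha> * \<beta> dvd e"
    then have e: "\<alpha> dvd e" "\<beta> dvd e" by (auto intro: dvd_trans)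
    then have "w n1 s [^] e = \<one>" using s by (metis dvdE nat_pow_one nat_pow_pow w_closed)
    then show "w n1 (s + m1) [^] e = \<one>" using e a by (simp add: split)
  qed
  then show ?thesis using ord_unique[of "w n1 (s + m1)" "\<alpha> * \<beta>"] by simp
qed

text \<open>The condition on \<open>s\<close> says that \<open>w n1 s\<close> is killed by
  \<open>\<beta>\<close>, and multiplying by \<open>w 0 m1\<close> turns it into a generator.
  Surjectivity holds because \<open>rotation_mem\<close> and \<open>complement_mem\<close> find both
  factors in a given subgroup.\<close>

lemma bij_cyclic_subgroups:
  assumes r: "[r ^ n1 = 1] (mod \<alpha>)"
  shows "bij_betw (\<lambda>s. generate G {w n1 (s + m1)}) {s. s < m \<and> m dvd s * geo_sum r \<beta> n1}
           {H \<in> cyclic_subgroups G. card H = \<alpha> * \<beta>}"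
    (is "bij_betw ?f ?S ?C")
proof -
  have mem: "?f s \<in> ?C" if "s \<in> ?S" for s
    using that ord_w[OF r, of s] generate_pow_card[of "w n1 (s + m1)"]
    by (auto simp: cyclic_subgroups_eq w_pow_eq_one_iff)
  have w_mem: "w n1 s \<in> ?f s" if "s \<in> ?S" for s
  proof -
    have H: "subgroup (?f s) G" "w 0 m1 \<in> ?f s"
      using mem[OF that] cyclic_subgroup_subgroup rotation_mem by auto
    have "w n1 (s + m1) \<in> ?f s" by (simp add: generate.incl)
    then have "w n1 (s + m1) \<otimes> inv (w 0 m1) \<in> ?f s"
      using H by (simp add: subgroup.m_closed subgroup.m_inv_closed)
    moreover have "w n1 s = w n1 (s + m1) \<otimes> inv (w 0 m1)"
      by (simp add: inv_solve_right w_mult)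
    ultimately show ?thesis by simp
  qed
  \<comment> \<open>Two such elements in one cyclic subgroup commute and differ by a power
    \<open>w 0 d\<close> of \<open>a\<close>, which is then killed by \<open>\<beta>\<close>; as
    \<open>m\<close> and \<open>\<beta>\<close> are coprime, it is trivial.\<close>
  have inj: "s = t" if s: "s \<in> ?S" and t: "t \<in> ?S" and eq: "?f s = ?f t" for s t
  proof -
    obtain x where x: "x \<in> carrier G" "?f s = range (\<lambda>k::nat. x [^] k)"
      using cyclic_subgroupE mem[OF s] by blast
    obtain i k :: nat where ik: "w n1 s = x [^] i" "w n1 t = x [^] k"
      using w_mem[OF s] w_mem[OF t] x eq by auto
    have comm: "w n1 s \<otimes> w n1 t = w n1 t \<otimes> w n1 s"
      using x ik by (simp add: nat_pow_mult add.commute)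
    \<comment> \<open>This is \<open>t - s\<close> modulo \<open>m\<close> within the natural
      numbers; \<open>s < m\<close> keeps the subtraction from truncating.\<close>
    define d where "d = t + (m - s)"
    have "[s + d = t] (mod m)" using s by (simp add: d_def cong_def)
    then have eq_t: "w n1 t = w n1 s \<otimes> w 0 d" by (simp add: w_mult w_eq_iff cong_sym_eq)
    then have d: "w 0 d = inv (w n1 s) \<otimes> w n1 t" by (simp add: inv_solve_left)
    have "w n1 s \<otimes> w 0 d = w 0 d \<otimes> w n1 s"
      using comm unfolding d by (metis inv_closed inv_solve_left m_assoc m_closed w_closed)
    then have "w n1 t [^] \<beta> = w n1 s [^] \<beta> \<otimes> w 0 d [^] \<beta>"
      unfolding eq_t by (intro pow_mult_distrib) auto
    then have "w 0 d [^] \<beta> = \<one>" using s t by (simp add: w_pow_eq_one_iff[symmetric])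
    then have "m dvd d * \<beta>" by (simp add: w_pow w_eq_one_iff)
    then have "m dvd d" using coprimes by (simp add: coprime_dvd_mult_left_iff)
    then have "[s = t] (mod m)"
      using \<open>[s + d = t] (mod m)\<close> by (metis cong_0_iff cong_add_lcancel_0_nat cong_sym cong_trans)
    then show ?thesis using s t by (simp add: cong_less_modulus_unique_nat)
  qed
  have surj: "H \<in> ?f ` ?S" if H: "H \<in> ?C" for H
  proof -
    have H': "H \<in> cyclic_subgroups G" "card H = \<alpha> * \<beta>" using H by auto
    obtain s where s: "s < m" "w n1 s \<in> H" "w n1 s [^] \<beta> = \<one>"
      using complement_mem[OF H'] .
    then have sS: "s \<in> ?S" by (simp add: w_pow_eq_one_iff)
    have "w n1 s \<otimes> w 0 m1 \<in> H"
      using s rotation_mem[OF H'] cyclic_subgroup_subgroup[OF H'(1)] by (simp add: subgroup.m_closed)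
    then have "?f s \<subseteq> H"
      using cyclic_subgroup_subgroup[OF H'(1)] by (intro generate_subgroup_incl) (auto simp: w_mult)
    moreover have "finite H"
      using cyclic_subgroup_subgroup[OF H'(1)] finite_carrier finite_subset subgroup.subset by blast
    ultimately have "?f s = H" using mem[OF sS] H' by (intro card_subset_eq) auto
    then show ?thesis using sS by auto
  qed
  show ?thesis unfolding bij_betw_def inj_on_def using mem inj surj by blast
qed

lemma card_cyclic_subgroups:
  "card {H \<in> cyclic_subgroups G. card H = \<alpha> * \<beta>} =
     (if [r ^ n1 = 1] (mod \<alpha>) then gcd m1 (geo_sum r \<beta> n1) else 0)"
proof (cases "[r ^ n1 = 1] (mod \<alpha>)")
  case True
  then have "card {H \<in> cyclic_subgroups G. card H = \<alpha> * \<beta>} = gcd m (geo_sum r \<beta> n1)"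
    using bij_betw_same_card[OF bij_cyclic_subgroups] card_dvd_mult[OF m_pos] by simp
  then show ?thesis using True gcd_mult_geo_sum[OF True] coprimes by (simp add: m_eq)
next
  case False
  then have "{H \<in> cyclic_subgroups G. card H = \<alpha> * \<beta>} = {}"
    using cyclic_imp_cong by blast
  then show ?thesis using False by (simp only: card.empty if_False)
qed

end

section \<open>Products of two cyclic subgroups\<close>

text \<open>\<open>m2 * n2\<close> and \<open>m3 * n3\<close> are the indices of \<open>H\<close>
  and \<open>K\<close>, and the mixed pairs are coprime because \<open>m\<close> and
  \<open>n\<close> are, so coprime indices give one direction. The converse treats
  \<open>n2\<close>, \<open>n3\<close> by factoring \<open>b\<close>, and \<open>m2\<close>,
  \<open>m3\<close> by counting.\<close>

lemma set_mult_eq_carrier_iff: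
  assumes m: "m = m2 * \<alpha>2" "m = m3 * \<alpha>3" and n: "n = n2 * \<beta>2" "n = n3 * \<beta>3"
    and H: "H \<in> cyclic_subgroups G" "card H = \<alpha>2 * \<beta>2"
    and K: "K \<in> cyclic_subgroups G" "card K = \<alpha>3 * \<beta>3"
  shows "H <#> K = carrier G \<longleftrightarrow> coprime m2 m3 \<and> coprime n2 n3"
proof
  note sub = cyclic_subgroup_subgroup[OF H(1)] cyclic_subgroup_subgroup[OF K(1)]
  have exp: "y [^] card L = \<one>" if "L \<in> cyclic_subgroups G" "y \<in> L" for L y
  proof -
    obtain x where x: "x \<in> carrier G" "ord x = card L" "L = range (\<lambda>k::nat. x [^] k)"
      using cyclic_subgroupE \<open>L \<in> cyclic_subgroups G\<close> by blast
    then show ?thesis using \<open>y \<in> L\<close> by (auto simp: nat_pow_pow pow_eq_id)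
  qed
  assume HK: "H <#> K = carrier G"
  \<comment> \<open>\<open>w 1 0\<close> is \<open>b\<close>. In \<open>b = h \<otimes> k\<close>
    the exponents of \<open>b\<close> in \<open>h\<close> and \<open>k\<close> are multiples of
    \<open>n2\<close> and \<open>n3\<close> with sum 1 modulo \<open>n\<close>, so
    \<open>gcd n2 n3\<close> divides 1.\<close>
  then have "w 1 0 \<in> H <#> K" by simp
  then obtain h k where hk: "h \<in> H" "k \<in> K" "w 1 0 = h \<otimes> k" by (auto simp: set_mult_def)
  then have "h \<in> carrier G" "k \<in> carrier G" using sub by (auto intro: subgroup.mem_carrier)
  then obtain i j i' j' where w: "h = w i j" "k = w i' j'" using span by blast
  have "n2 dvd i" "n3 dvd i'"
    using dvd_exponent[OF m(1) n(1), of i j] dvd_exponent[OF m(2) n(2), of i' j']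
      exp[OF H(1) hk(1)] exp[OF K(1) hk(2)] H K w by auto
  then have "gcd n2 n3 dvd i + i'" by (meson dvd_add dvd_trans gcd_dvd1 gcd_dvd2)
  moreover have "[1 = i + i'] (mod n)" using hk(3) by (simp add: w w_mult w_eq_iff)
  then have "[1 = i + i'] (mod gcd n2 n3)"
    by (rule cong_dvd_modulus_nat) (simp add: n(1) dvd_mult2)
  ultimately have "gcd n2 n3 dvd 1" using cong_dvd_iff by blast
  then have n_cop: "coprime n2 n3" by (simp add: coprime_iff_gcd_eq_1)

  \<comment> \<open>\<open>H \<inter> K\<close> contains \<open>a ^ lcm m2 m3\<close>, so counting \<open>H <#> K\<close> makes \<open>gcd m2 m3\<close> divide \<open>n\<close> as well as \<open>m\<close>.\<close>
  define g L where "g = gcd m2 m3" and "L = lcm m2 m3"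
  have gL: "L * g = m2 * m3" by (simp add: g_def L_def mult.commute)
  have "L dvd m" unfolding L_def using m by (metis dvd_triv_left lcm_least)
  then obtain \<gamma> where \<gamma>: "m = L * \<gamma>" by (auto elim!: dvdE)
  have "\<gamma> > 0" "L > 0" using m_pos \<gamma> by auto
  have pow: "w 0 L \<in> S" if "subgroup S G" "w 0 d \<in> S" "d dvd L" for S d
  proof -
    obtain e where "L = d * e" using \<open>d dvd L\<close> by (auto elim!: dvdE)
    then have "w 0 L = w 0 d [^] e" by (simp add: w_pow)
    then show ?thesis using that subgroup_int_pow_closed[of S "w 0 d" "int e"]
      by (simp add: int_pow_int)
  qed
  have "w 0 L \<in> H \<inter> K"
    using pow[OF sub(1) rotation_mem[OF m(1) n(1) H]] pow[OF sub(2) rotation_mem[OF m(2) n(2) K]]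
    by (simp add: L_def)
  then have "generate G {w 0 L} \<subseteq> H \<inter> K"
    using subgroups_Inter_pair[OF sub] by (intro generate_subgroup_incl) auto
  then have "ord (w 0 L) dvd card (H \<inter> K)"
    using subgroups_Inter_pair[OF sub] generate_is_subgroup[of "{w 0 L}"]
    by (simp add: generate_pow_card card_dvd_card_of_subset)
  moreover have "w 0 L [^] e = \<one> \<longleftrightarrow> \<gamma> dvd e" for e :: nat
    using \<open>L > 0\<close> by (simp add: w_pow w_eq_one_iff \<gamma>)
  then have "ord (w 0 L) = \<gamma>" using ord_unique[of "w 0 L" \<gamma>] by simp
  ultimately obtain t where t: "card (H \<inter> K) = \<gamma> * t" by (auto elim!: dvdE)
  have eq: "(\<alpha>2 * \<beta>2) * (\<alpha>3 * \<beta>3) = m * n * (\<gamma> * t)"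
    using card_mult_card_inter[OF finite_carrier sub] by (simp add: HK H K t card_carrier)
  have "(m * n) * (m * n) = (m2 * n2) * (m3 * n3) * ((\<alpha>2 * \<beta>2) * (\<alpha>3 * \<beta>3))"
  proof -
    have "(m * n) * (m * n) = (m2 * \<alpha>2 * (n2 * \<beta>2)) * (m3 * \<alpha>3 * (n3 * \<beta>3))"
      using m n by metis
    then show ?thesis by (simp only: mult_ac)
  qed
  also have "\<dots> = (L * g) * (n2 * n3) * (m * n * (\<gamma> * t))"
    unfolding eq gL by (simp only: mult_ac)
  also have "\<dots> = (m * n) * (m * (g * (n2 * n3 * t)))"
    unfolding \<gamma> by (simp only: mult_ac)
  finally have "n = g * (n2 * n3 * t)" using m_pos n_pos by simp
  then have "g dvd n" by (metis dvd_triv_left)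
  moreover have "g dvd m" by (simp add: g_def m(1) dvd_mult2)
  ultimately have "g dvd 1" using coprime_common_divisor[OF coprime_m_n] by blast
  then show "coprime m2 m3 \<and> coprime n2 n3" using n_cop by (simp add: g_def coprime_iff_gcd_eq_1)
next
  assume cop: "coprime m2 m3 \<and> coprime n2 n3"
  have "coprime m2 n3" "coprime n2 m3"
    using coprime_m_n by (auto simp: m(1) n(2) coprime_commute) (use coprime_m_n in \<open>simp add: m(2) n(1) coprime_commute\<close>)
  then have "coprime (m2 * n2) (m3 * n3)" using cop by simp
  moreover have "card H * (m2 * n2) = card (carrier G)"
    unfolding H(2) card_carrier by (subst m(1), subst n(1)) (simp only: mult_ac)
  moreover have "card K * (m3 * n3) = card (carrier G)"
    unfolding K(2) card_carrier by (subst m(2), subst n(2)) (simp only: mult_ac)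
  ultimately show "H <#> K = carrier G"
    using set_mult_eq_carrier_of_coprime_index[OF finite_carrier cyclic_subgroup_subgroup[OF H(1)]
        cyclic_subgroup_subgroup[OF K(1)]] by blast
qed

text \<open>The classes \<open>C k l\<close> partition the cyclic subgroups by order, so the
  factorizing pairs form the disjoint union of \<open>C m2 n2 \<times> C m3 n3\<close> over the
  quadruples in \<open>Q\<close>. A class violating its congruence is empty, which reduces
  \<open>Q\<close> to the stated index set.\<close>

lemma CF2_eq:
  "CF2 G = (\<Sum>(m2, m3, n2, n3) \<in> {(m2, m3, n2, n3).
       m2 dvd m \<and> m3 dvd m \<and> n2 dvd n \<and> n3 dvd n \<and> coprime m2 m3 \<and> coprime n2 n3 \<and>
       [r ^ n2 = 1] (mod (m div m2)) \<and> [r ^ n3 = 1] (mod (m div m3))}.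
     gcd m2 (geo_sum r (n div n2) n2) * gcd m3 (geo_sum r (n div n3) n3))"
    (is "_ = sum ?g ?S")
proof -
  define C where "C k l = {H \<in> cyclic_subgroups G. card H = (m div k) * (n div l)}" for k l
  define Q where "Q = {(m2, m3, n2, n3). m2 dvd m \<and> m3 dvd m \<and> n2 dvd n \<and> n3 dvd n \<and>
      coprime m2 m3 \<and> coprime n2 n3}"
  define F where "F = (\<lambda>(m2, m3, n2, n3). C m2 n2 \<times> C m3 n3)"
  have finQ: "finite Q"
    by (rule finite_subset[of _ "{..m} \<times> {..m} \<times> {..n} \<times> {..n}"])
      (use m_pos n_pos in \<open>auto simp: Q_def dest: dvd_imp_le\<close>)
  have card_C: "card (C k l) =
      (if [r ^ l = 1] (mod (m div k)) then gcd k (geo_sum r (n div l) l) else 0)"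
    if "k dvd m" "l dvd n" for k l
    unfolding C_def using that by (intro card_cyclic_subgroups) auto
  have finC: "finite (C k l)" for k l
  proof -
    have "C k l \<subseteq> Pow (carrier G)"
      using cyclic_subgroup_subgroup subgroup.subset by (fastforce simp: C_def)
    then show ?thesis using finite_carrier finite_subset by blast
  qed
  have C_eqD: "k = k' \<and> l = l'"
    if "k dvd m" "k' dvd m" "l dvd n" "l' dvd n" "H \<in> C k l" "H \<in> C k' l'" for k k' l l' H
  proof -
    \<comment> \<open>\<open>m\<close> is coprime to \<open>n div l\<close> and \<open>n\<close> to
      \<open>m div k\<close>, so the two factors of \<open>card H\<close> are its gcds with
      \<open>m\<close> and \<open>n\<close>; thus the order determines \<open>k\<close> and
      \<open>l\<close>.\<close>
    have gcds: "gcd m (card H) = m div k" "gcd n (card H) = n div l"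
      if kl: "k dvd m" "l dvd n" "H \<in> C k l" for k l
    proof -
      have "coprime m (n div l)" "coprime n (m div k)"
        using coprime_m_n kl by (auto simp: coprime_commute elim!: dvdE)
      then show "gcd m (card H) = m div k" "gcd n (card H) = n div l"
        using kl by (auto simp: C_def gcd_mult_right_right_cancel gcd_mult_right_left_cancel
            gcd_nat.absorb2)
    qed
    have "m div k = m div k'" "n div l = n div l'"
      using gcds[of k l] gcds[of k' l'] that by auto
    then show ?thesis using that m_pos n_pos
      by (metis dvd_mult_div_cancel less_not_refl mult_0_right mult_cancel2)
  qed
  have C_ex: "\<exists>k l. k dvd m \<and> l dvd n \<and> H \<in> C k l" if H: "H \<in> cyclic_subgroups G" for H
  proof -
    have "card H dvd card (carrier G)"
      using cyclic_subgroup_subgroup[OF H]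
      by (intro card_dvd_card_of_subset subgroup_self) (auto dest: subgroup.subset)
    then have "card H dvd m * n" by (simp add: card_carrier)
    then obtain \<alpha> \<beta> where "card H = \<alpha> * \<beta>" "\<alpha> dvd m" "\<beta> dvd n"
      using division_decomp by blast
    then have "m div \<alpha> dvd m \<and> n div \<beta> dvd n \<and> H \<in> C (m div \<alpha>) (n div \<beta>)"
      using H m_pos n_pos by (auto simp: C_def div_div_eq_right elim!: dvdE)
    then show ?thesis by blast
  qed
  have mem_iff: "H <#> K = carrier G \<longleftrightarrow> coprime m2 m3 \<and> coprime n2 n3"
    if "m2 dvd m" "m3 dvd m" "n2 dvd n" "n3 dvd n" "H \<in> C m2 n2" "K \<in> C m3 n3" for m2 m3 n2 n3 H K
    using that by (intro set_mult_eq_carrier_iff[of _ "m div m2" _ "m div m3" _ "n div n2" _ "n div n3"])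
      (auto simp: C_def)
  have "{(H, K). H \<in> cyclic_subgroups G \<and> K \<in> cyclic_subgroups G \<and> H <#> K = carrier G} =
      (\<Union>q\<in>Q. F q)" (is "?P = _")
  proof (intro equalityI subsetI)
    fix p assume "p \<in> ?P"
    then obtain H K where p: "p = (H, K)" "H \<in> cyclic_subgroups G" "K \<in> cyclic_subgroups G"
      "H <#> K = carrier G" by auto
    obtain m2 n2 m3 n3 where kl: "m2 dvd m" "n2 dvd n" "H \<in> C m2 n2" "m3 dvd m" "n3 dvd n" "K \<in> C m3 n3"
      using C_ex p by metis
    then have "(m2, m3, n2, n3) \<in> Q" using mem_iff p by (auto simp: Q_def)
    moreover have "p \<in> F (m2, m3, n2, n3)" using kl p by (simp add: F_def)
    ultimately show "p \<in> (\<Union>q\<in>Q. F q)" by blast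
  next
    fix p assume "p \<in> (\<Union>q\<in>Q. F q)"
    then obtain m2 m3 n2 n3 H K where "(m2, m3, n2, n3) \<in> Q" "p = (H, K)" "H \<in> C m2 n2" "K \<in> C m3 n3"
      by (auto simp: F_def)
    then show "p \<in> ?P" using mem_iff[of m2 m3 n2 n3 H K] by (auto simp: Q_def C_def)
  qed
  then have "CF2 G = card (\<Union>q\<in>Q. F q)" by (simp add: CF2_def)
  also have "\<dots> = (\<Sum>q\<in>Q. card (F q))"
  proof (rule card_UN_disjoint[OF finQ])
    show "\<forall>q\<in>Q. finite (F q)" using finC by (auto simp: F_def)
    show "\<forall>q\<in>Q. \<forall>q'\<in>Q. q \<noteq> q' \<longrightarrow> F q \<inter> F q' = {}"
      by (auto simp: Q_def F_def dest: C_eqD)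
  qed
  also have "\<dots> = sum ?g ?S"
  proof (rule sum.mono_neutral_cong_right[OF finQ])
    show "?S \<subseteq> Q" by (auto simp: Q_def)
    show "\<forall>q\<in>Q - ?S. card (F q) = 0"
      by (auto simp: Q_def F_def card_cartesian_product card_C split: if_splits)
    show "card (F q) = ?g q" if "q \<in> ?S" for q
      using that by (auto simp: F_def card_cartesian_product card_C)
  qed
  finally show ?thesis .
qed

end

text \<open>For \<open>r \<noteq> 1\<close> the geometric series makes the integer division exact:
  \<open>k > 0\<close> gives a nonzero divisor, also for \<open>r = 0\<close>, where it is
  -1.\<close>

lemma pow_quot_eq_geo_sum:
  assumes "k dvd n" "n > 0"
  shows "pow_quot r n k = int (geo_sum r (n div k) k)"
proof (cases "r = 1")
  case True
  then show ?thesis by (simp add: pow_quot_def geo_sum_def)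
next
  case False
  have k: "k > 0" using assms by (auto intro: Nat.gr0I)
  have "r ^ k \<noteq> 1" using False k by simp
  then have "int r ^ k \<noteq> 1" by (metis of_nat_1 of_nat_eq_iff of_nat_power)
  moreover have "int r ^ n - 1 = (int r ^ k - 1) * int (geo_sum r (n div k) k)"
    using power_diff_1_eq[of "int r ^ k" "n div k"] assms
    by (simp add: geo_sum_def power_mult[symmetric] mult.commute)
  ultimately show ?thesis using False by (simp add: pow_quot_def)
qed

section \<open>The presented group\<close>

text \<open>The pair \<open>(i, j)\<close> stands for \<open>b\<^sup>i a\<^sup>j\<close>, and a letter acts by right multiplication. Reducing modulo
  \<open>n\<close> and \<open>m\<close> is left to \<open>zm_cong\<close>; a formal inverse acts as the \<open>(m - 1)\<close>-st or \<open>(n - 1)\<close>-st power.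
  The action separates the normal forms, so that none of them are identified by the relations.\<close>

fun zm_act :: "nat \<Rightarrow> nat \<Rightarrow> nat \<Rightarrow> zm_gen \<times> bool \<Rightarrow> nat \<times> nat \<Rightarrow> nat \<times> nat" where
  "zm_act m n r (Gen_a, s) (i, j) = (i, j + (if s then m - 1 else 1))"
| "zm_act m n r (Gen_b, s) (i, j) = (i + (if s then n - 1 else 1), j * r ^ (if s then n - 1 else 1))"

definition zm_cong :: "nat \<Rightarrow> nat \<Rightarrow> nat \<times> nat \<Rightarrow> nat \<times> nat \<Rightarrow> bool" where
  "zm_cong m n p q \<longleftrightarrow> [fst p = fst q] (mod n) \<and> [snd p = snd q] (mod m)"

lemma zm_act_cong: "zm_cong m n p q \<Longrightarrow> zm_cong m n (zm_act m n r x p) (zm_act m n r x q)"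
proof -
  have "[Suc i = Suc j] (mod k)" if "[i = j] (mod k)" for i j k
    using cong_add[OF that cong_refl[of 1]] by simp
  then show "zm_cong m n p q \<Longrightarrow> ?thesis"
    by (cases p; cases q; cases x; cases "fst x") (auto simp: zm_cong_def intro: cong_add cong_mult)
qed

lemma zm_cong_trans: "zm_cong m n p q \<Longrightarrow> zm_cong m n q s \<Longrightarrow> zm_cong m n p s"
  by (auto simp: zm_cong_def intro: cong_trans)

lemma fold_zm_act_cong:
  "zm_cong m n p q \<Longrightarrow> zm_cong m n (fold (zm_act m n r) u p) (fold (zm_act m n r) u q)"
  by (induction u arbitrary: p q) (simp_all add: zm_act_cong)

lemma fold_zm_act_replicate:
  "fold (zm_act m n r) (replicate k (Gen_a, False)) (i, j) = (i, j + k)"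
  "fold (zm_act m n r) (replicate k (Gen_b, False)) (i, j) = (i + k, j * r ^ k)"
  by (induction k arbitrary: i j) (auto simp: mult.assoc)

text \<open>Induction on the derivation. The congruence \<open>[r ^ n = 1] (mod m)\<close> makes
  \<open>n\<close> letters \<open>b\<close>, and \<open>b\<close> next to its formal inverse, act
  trivially on the second coordinate.\<close>

lemma pres_eq_imp_zm_cong:
  assumes m: "m > 0" and n: "n > 0" and r: "[r ^ n = 1] (mod m)"
    and "pres_eq (zm_relations m n r) u v"
  shows "zm_cong m n (fold (zm_act m n r) u p) (fold (zm_act m n r) v p)"
  using assms(4)
proof (induction arbitrary: p rule: pres_eq.induct)
  case (pres_append u u' v v')
  show ?case unfolding fold_append comp_apply
    by (rule zm_cong_trans[OF fold_zm_act_cong[OF pres_append.IH(1)] pres_append.IH(2)])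
next
  case (pres_cancel x s)
  obtain i j where p: "p = (i, j)" by fastforce
  have n1: "r ^ (n - 1) * r = r ^ n" "r * r ^ (n - 1) = r ^ n"
    using n by (simp_all add: power_eq_if mult.commute)
  have "[j * r ^ n = j * 1] (mod m)" using r by (intro cong_mult) auto
  then show ?case using m n n1
    by (cases x) (auto simp: p zm_cong_def mult.assoc cong_def)
next
  case (pres_rel u v)
  obtain i j where p: "p = (i, j)" by fastforce
  have n1: "r ^ (n - Suc 0) * r = r ^ n" using n by (simp add: power_eq_if)
  have jr: "[j * r ^ n = j * 1] (mod m)" using r by (intro cong_mult) auto
  \<comment> \<open>The word for the conjugate of \<open>a\<close> sends the second coordinate
    \<open>j\<close> to \<open>(j * r ^ (n - 1) + 1) * r\<close>, that is
    \<open>j * r ^ n + r\<close>, whereas \<open>r\<close> letters \<open>a\<close> send it to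
    \<open>j + r\<close>.\<close>
  have "[r + j * r ^ n = r + j] (mod m)"
    using cong_add[OF cong_refl[of r] jr] by simp
  then show ?case using pres_rel jr n n1
    by (auto simp: p zm_relations_def zm_cong_def fold_zm_act_replicate cong_def mult.assoc
        add.commute[of j r] simp del: fold_replicate)
next
  case (pres_trans u v w)
  then show ?case using zm_cong_trans by blast
qed (auto simp: zm_cong_def intro: cong_sym)

text \<open>Normal forms span because every letter is some \<open>w i j\<close>, inverse letters
  being powers, and these are closed under products. Uniqueness comes from the action: the word of
  \<open>w i j\<close> sends \<open>(0, 0)\<close> to \<open>(i, j)\<close>.\<close>

lemma zm_group_ZM:
  assumes m: "m > 0" and n: "n > 0" and cop: "coprime m n" and r: "[r ^ n = 1] (mod m)"
  shows "zm_group (ZM m n r) (pres_class (zm_relations m n r) [(Gen_a, False)])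
           (pres_class (zm_relations m n r) [(Gen_b, False)]) m n r"
proof -
  let ?R = "zm_relations m n r" and ?G = "ZM m n r"
  define cl where "cl = pres_class ?R"
  let ?a = "cl [(Gen_a, False)]" and ?b = "cl [(Gen_b, False)]"
  interpret group ?G unfolding ZM_def by (rule group_presented_group)
  have car: "carrier ?G = range cl" and one: "\<one>\<^bsub>?G\<^esub> = cl []"
    by (simp_all add: ZM_def presented_group_def cl_def)
  have mult: "cl u \<otimes>\<^bsub>?G\<^esub> cl v = cl (u @ v)" for u v
    by (simp add: ZM_def cl_def pres_class_mult)
  have eq: "cl u = cl v \<longleftrightarrow> pres_eq ?R u v" for u v
    by (simp add: cl_def pres_class_eq_iff)
  have pow: "cl [x] [^]\<^bsub>?G\<^esub> k = cl (replicate k x)" for x and k :: nat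
    by (induction k) (simp_all add: one mult replicate_append_same)
  have cl_rel: "cl u = cl v" if "(u, v) \<in> ?R" for u v
    using that by (simp add: eq pres_rel)
  have cancel: "cl [(x, s)] \<otimes>\<^bsub>?G\<^esub> cl [(x, \<not> s)] = \<one>\<^bsub>?G\<^esub>" for x s
    by (simp add: mult one eq pres_cancel)
  have am: "?a [^]\<^bsub>?G\<^esub> m = \<one>\<^bsub>?G\<^esub>" and bn: "?b [^]\<^bsub>?G\<^esub> n = \<one>\<^bsub>?G\<^esub>"
    by (simp_all add: pow one cl_rel zm_relations_def)
  have conj: "cl [(Gen_b, True), (Gen_a, False), (Gen_b, False)] = ?a [^]\<^bsub>?G\<^esub> r"
    unfolding pow by (intro cl_rel) (simp add: zm_relations_def)
  have ab: "?a \<otimes>\<^bsub>?G\<^esub> ?b = ?b \<otimes>\<^bsub>?G\<^esub> ?a [^]\<^bsub>?G\<^esub> r"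
  proof -
    have "?b \<otimes>\<^bsub>?G\<^esub> ?a [^]\<^bsub>?G\<^esub> r = (?b \<otimes>\<^bsub>?G\<^esub> cl [(Gen_b, True)]) \<otimes>\<^bsub>?G\<^esub> (?a \<otimes>\<^bsub>?G\<^esub> ?b)"
      unfolding conj[symmetric] by (simp add: mult)
    also have "?b \<otimes>\<^bsub>?G\<^esub> cl [(Gen_b, True)] = \<one>\<^bsub>?G\<^esub>" using cancel[of Gen_b False] by simp
    finally show ?thesis by (simp add: car mult)
  qed
  interpret zm_relators ?G ?a ?b m n r
    by unfold_locales (auto simp: car am bn ab)
  have inverse: "cl [(x, True)] = cl [(x, False)] [^]\<^bsub>?G\<^esub> (d - 1)"
    if "d > 0" "cl [(x, False)] [^]\<^bsub>?G\<^esub> d = \<one>\<^bsub>?G\<^esub>" for x and d :: nat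
  proof -
    have "cl [(x, False)] [^]\<^bsub>?G\<^esub> (d - 1) \<otimes>\<^bsub>?G\<^esub> cl [(x, False)] = \<one>\<^bsub>?G\<^esub>"
      using that nat_pow_Suc[of "cl [(x, False)]" "d - 1"] by simp
    moreover have "cl [(x, True)] \<otimes>\<^bsub>?G\<^esub> cl [(x, False)] = \<one>\<^bsub>?G\<^esub>"
      using cancel[of x True] by simp
    moreover have "cl [(x, s)] \<in> carrier ?G" for s by (simp add: car)
    ultimately show ?thesis by (metis nat_pow_closed right_cancel)
  qed
  have w_letter: "\<exists>i j. cl [p] = w i j" for p
  proof -
    obtain x s where p: "p = (x, s)" by fastforce
    have "cl [(Gen_a, False)] = w 0 1" "cl [(Gen_b, False)] = w 1 0"
      "cl [(Gen_a, True)] = w 0 (m - 1)" "cl [(Gen_b, True)] = w (n - 1) 0"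
      using inverse[OF m am] inverse[OF n bn] by (simp_all add: w_def)
    then show ?thesis unfolding p by (cases x; cases s) metis+
  qed
  have "\<exists>i j. cl u = w i j" for u
  proof (induction u)
    case Nil
    then show ?case using w_0_0 one by metis
  next
    case (Cons p u)
    then show ?case using w_letter[of p] mult[of "[p]" u] w_mult by (metis append_Cons append_Nil)
  qed
  then have span: "\<exists>i j. x = w i j" if "x \<in> carrier ?G" for x
    using that car by auto
  have w_cl: "w i j = cl (replicate i (Gen_b, False) @ replicate j (Gen_a, False))" for i j
    by (simp add: w_def pow mult)
  have uniq: "[i = k] (mod n) \<and> [j = l] (mod m)" if "w i j = w k l" for i j k l
    using pres_eq_imp_zm_cong[OF m n r that[unfolded w_cl eq], of "(0, 0)"]
    unfolding fold_append comp_apply fold_zm_act_replicate by (simp add: zm_cong_def)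
  have "zm_group ?G ?a ?b m n r"
    by unfold_locales (use m n cop r span uniq in auto)
  then show ?thesis by (simp add: cl_def)
qed

section \<open>The formula for ZM-groups and the example ZM(9, 4, 8)\<close>

lemma CF2_ZM:
  assumes m: "m > 0" and n: "n > 0" and cop: "coprime m n" and r: "[r ^ n = 1] (mod m)"
  shows "int (CF2 (ZM m n r)) =
             (\<Sum>(m2, m3, n2, n3) \<in>
                {(m2, m3, n2, n3).
                   m2 dvd m \<and> m3 dvd m \<and> n2 dvd n \<and> n3 dvd n \<and>
                   gcd m2 m3 = 1 \<and> gcd n2 n3 = 1 \<and>
                   int (m div m2) dvd int r ^ n2 - 1 \<and>
                   int (m div m3) dvd int r ^ n3 - 1}.
                gcd (int m2) (pow_quot r n n2) * gcd (int m3) (pow_quot r n n3))"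
proof -
  have cong: "[r ^ k = 1] (mod d) \<longleftrightarrow> int d dvd int r ^ k - 1" for k d
    by (metis cong_iff_dvd_diff cong_int_iff of_nat_1 of_nat_power)
  show ?thesis
    unfolding zm_group.CF2_eq[OF zm_group_ZM[OF assms]] of_nat_sum
    by (intro sum.cong, simp only: cong coprime_iff_gcd_eq_1)
      (auto simp: pow_quot_eq_geo_sum n)
qed

theorem theorem3p2:
  shows "(\<forall>m n r :: nat.
           m \<ge> 1 \<and> n \<ge> 1 \<and> gcd m n = 1 \<and> gcd (int m) (int r - 1) = 1 \<and> [r ^ n = 1] (mod m) \<longrightarrow>
           int (CF2 (ZM m n r)) =
             (\<Sum>(m2, m3, n2, n3) \<in>
                {(m2, m3, n2, n3).
                   m2 dvd m \<and> m3 dvd m \<and> n2 dvd n \<and> n3 dvd n \<and>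
                   gcd m2 m3 = 1 \<and> gcd n2 n3 = 1 \<and>
                   int (m div m2) dvd int r ^ n2 - 1 \<and>
                   int (m div m3) dvd int r ^ n3 - 1}.
                gcd (int m2) (pow_quot r n n2) * gcd (int m3) (pow_quot r n n3)))
         \<and> CF2 (ZM 9 4 8) = 36"
proof
  show "\<forall>m n r :: nat.
           m \<ge> 1 \<and> n \<ge> 1 \<and> gcd m n = 1 \<and> gcd (int m) (int r - 1) = 1 \<and> [r ^ n = 1] (mod m) \<longrightarrow>
           int (CF2 (ZM m n r)) =
             (\<Sum>(m2, m3, n2, n3) \<in>
                {(m2, m3, n2, n3).
                   m2 dvd m \<and> m3 dvd m \<and> n2 dvd n \<and> n3 dvd n \<and>
                   gcd m2 m3 = 1 \<and> gcd n2 n3 = 1 \<and>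
                   int (m div m2) dvd int r ^ n2 - 1 \<and>
                   int (m div m3) dvd int r ^ n3 - 1}.
                gcd (int m2) (pow_quot r n n2) * gcd (int m3) (pow_quot r n n3))"
    using CF2_ZM by (auto simp: coprime_iff_gcd_eq_1)
  have d9: "d dvd 9 \<longleftrightarrow> d \<in> {1, 3, 9}" and d4: "d dvd 4 \<longleftrightarrow> d \<in> {1, 2, 4}" for d :: nat
  proof -
    have "d \<in> {1, 3, 9}" if "d dvd 9"
    proof -
      have "d \<in> {..9}" using that by (auto dest: dvd_imp_le)
      also have "{..9} = {0, 1, 2, 3, 4, 5, 6, 7, 8, 9 :: nat}" by auto
      finally show ?thesis using that by auto
    qed
    moreover have "d \<in> {1, 2, 4}" if "d dvd 4"
    proof -
      have "d \<in> {..4}" using that by (auto dest: dvd_imp_le)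
      also have "{..4} = {0, 1, 2, 3, 4 :: nat}" by auto
      finally show ?thesis using that by auto
    qed
    ultimately show "d dvd 9 \<longleftrightarrow> d \<in> {1, 3, 9}" "d dvd 4 \<longleftrightarrow> d \<in> {1, 2, 4}" by auto
  qed
  have gcd9: "gcd x y = 1 \<longleftrightarrow> x = 1 \<or> y = 1" if "x \<in> {1, 3, 9}" "y \<in> {1, 3, 9}" for x y :: nat
    using that by auto
  have gcd4: "gcd x y = 1 \<longleftrightarrow> x = 1 \<or> y = 1" if "x \<in> {1, 2, 4}" "y \<in> {1, 2, 4}" for x y :: nat
    using that by auto
  \<comment> \<open>8 - 1 = 7 is coprime to 9, while 8^2 - 1 = 63 and 8^4 - 1 = 4095 are multiples
    of 9.\<close>
  have dvd: "int (9 div x) dvd int 8 ^ k - 1 \<longleftrightarrow> k \<noteq> 1 \<or> x = 9"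
    if "x \<in> {1, 3, 9}" "k \<in> {1, 2, 4}" for x k
    using that by auto
  have conds: "(m2 dvd 9 \<and> m3 dvd 9 \<and> n2 dvd 4 \<and> n3 dvd 4 \<and>
         gcd m2 m3 = 1 \<and> gcd n2 n3 = 1 \<and>
         int (9 div m2) dvd int 8 ^ n2 - 1 \<and>
         int (9 div m3) dvd int 8 ^ n3 - 1) \<longleftrightarrow>
        (m2 \<in> {1, 3, 9} \<and> m3 \<in> {1, 3, 9} \<and> n2 \<in> {1, 2, 4} \<and> n3 \<in> {1, 2, 4} \<and>
         (m2 = 1 \<or> m3 = 1) \<and> (n2 = 1 \<or> n3 = 1) \<and> (n2 \<noteq> 1 \<or> m2 = 9) \<and> (n3 \<noteq> 1 \<or> m3 = 9))"
    for m2 m3 n2 n3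
    unfolding d9 d4 by (simp only: gcd9 gcd4 dvd cong: conj_cong)
  \<comment> \<open>\<open>n2 = 1\<close> forces \<open>m2 = 9\<close>, hence \<open>m3 = 1\<close>
    and \<open>n3 \<noteq> 1\<close>; the case \<open>n3 = 1\<close> is symmetric.\<close>
  have tuples: "m2 \<in> {1, 3, 9} \<and> m3 \<in> {1, 3, 9} \<and> n2 \<in> {1, 2, 4} \<and> n3 \<in> {1, 2, 4} \<and>
         (m2 = 1 \<or> m3 = 1) \<and> (n2 = 1 \<or> n3 = 1) \<and> (n2 \<noteq> 1 \<or> m2 = 9) \<and> (n3 \<noteq> 1 \<or> m3 = 9) \<longleftrightarrow>
       (m2, m3, n2, n3) \<in> {(9, 1, 1, 2), (9, 1, 1, 4), (1, 9, 2, 1), (1, 9, 4, 1)}"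
    (is "?l \<longleftrightarrow> ?r") for m2 m3 n2 n3 :: nat
  proof
    assume l: ?l
    show ?r
    proof (cases "m2 = 1")
      case True
      then have "n2 \<noteq> 1" using l by linarith
      moreover from this have "n3 = 1" using l by blast
      moreover from this have "m3 = 9" using l by blast
      moreover have "n2 \<in> {1, 2, 4}" using l by blast
      ultimately show ?thesis using True by auto
    next
      case False
      then have "m3 = 1" using l by blast
      moreover from this have "n3 \<noteq> 1" using l by linarith
      moreover from this have "n2 = 1" using l by blast
      moreover from this have "m2 = 9" using l by blast
      moreover have "n3 \<in> {1, 2, 4}" using l by blast
      ultimately show ?thesis by auto
    qed
  qed auto
  have S: "{(m2, m3, n2, n3).
                   m2 dvd 9 \<and> m3 dvd 9 \<and> n2 dvd 4 \<and> n3 dvd 4 \<and>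
                   gcd m2 m3 = 1 \<and> gcd n2 n3 = 1 \<and>
                   int (9 div m2) dvd int 8 ^ n2 - 1 \<and>
                   int (9 div m3) dvd int 8 ^ n3 - 1} =
      {(9, 1, 1, 2), (9, 1, 1, 4), (1, 9, 2, 1), (1, 9, 4, 1)}"
    unfolding conds tuples by auto
  have "coprime (9 :: nat) 4" by (simp add: coprime_iff_gcd_eq_1 gcd_non_0_nat)
  \<comment> \<open>Each of the four quadruples contributes gcd(9, 4095/7) = gcd(9, 585) =
    9.\<close>
  then have "int (CF2 (ZM 9 4 8)) = 36"
    by (subst CF2_ZM) (simp_all only: S, simp_all add: pow_quot_def cong_def)
  then show "CF2 (ZM 9 4 8) = 36" by simp
qed

end
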